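(* Let $w,w'$ be binary words. (1) If $w'$ has more than two runs, then $[\sigma(w)]$ contains $[\sigma(w')]$ if and only if $w'$ is a subsequence of $w$. (2) If $w' = 0^{a+1}1^b$ for some $a,b \geq 0$, then $[\sigma(w)]$ contains $[\sigma(w')]$ if and only if $w$ contains $0^{a+1}1^b$ or $1^{b+1}0^a$ as a subsequence. (3) If $w' = 1^{b+1}0^a$ for some $a,b \geq 0$, then $[\sigma(w)]$ contains $[\sigma(w')]$ if and only if $w$ contains $0^{a+1}1^b$ or $1^{b+1}0^a$ as a subsequence.
   Context: A binary word is a finite sequence over $\{0,1\}$; a run is a maximal block of consecutive equal letters; subsequences need not be contiguous. For a binary word $w=w_1\cdots w_{n-1}$, $\sigma(w)=\sigma_1\cdots\sigma_n$ is the permutation of $[n]$ where, for $k=1,\dots,n-1$, $\sigma_k$ is the minimum of the unused values of $[n]$ if $w_k=0$ and the maximum if $w_k=1$, and $\sigma_n$ is the remaining value. A circular permutation $[\pi]$ is the set of all rotations of $\pi$; $[\sigma]$ contains $[\pi]$ if some rotation of $\sigma$ has a subsequence order-isomorphic to $\pi$. *)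

theory Defs
  imports Main "HOL-Library.Sublist"
begin

text \<open>
  Binary words are lists of booleans, with \<^term>\<open>False\<close> for the letter 0 and \<^term>\<open>True\<close> for
  the letter 1.  Permutations of $[n]$ are written in one-line notation, as lists of naturals.
  Subsequences, not necessarily contiguous, are those of \<^const>\<open>subseq\<close>.
\<close>

text \<open>A run is recorded by the pair of its first and last position, counted from 0.\<close>

definition runs :: "'a list \<Rightarrow> (nat \<times> nat) set" where
  "runs w = {(i, j). i \<le> j \<and> j < length w \<and> (\<forall>k. i \<le> k \<and> k \<le> j \<longrightarrow> w ! k = w ! i)
     \<and> (i = 0 \<or> w ! (i - 1) \<noteq> w ! i) \<and> (Suc j = length w \<or> w ! Suc j \<noteq> w ! j)}"

lemma finite_runs: "finite (runs w)"
proof (rule finite_subset)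
  show "runs w \<subseteq> {..<length w} \<times> {..<length w}"
    by (rule subsetI) (simp add: runs_def split_beta mem_Times_iff)
qed simp

text \<open>The second argument is the set of values not yet used; it has one element more than the word.\<close>

fun fill :: "bool list \<Rightarrow> nat set \<Rightarrow> nat list" where
  "fill [] A = [the_elem A]"
| "fill (c # w) A = (let m = (if c then Max A else Min A) in m # fill w (A - {m}))"

definition sigma :: "bool list \<Rightarrow> nat list" where
  "sigma w = fill w {1..length w + 1}"

lemma fill_perm:
  "finite A \<Longrightarrow> card A = Suc (length w) \<Longrightarrow> distinct (fill w A) \<and> set (fill w A) = A"
proof (induction w arbitrary: A)
  case Nil
  then obtain x where "A = {x}" by (auto simp: card_Suc_eq)
  then show ?case by simp
next
  case (Cons c w)
  define m where "m = (if c then Max A else Min A)"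
  have "A \<noteq> {}" using Cons.prems by auto
  then have m: "m \<in> A" using Cons.prems by (simp add: m_def)
  have "distinct (fill w (A - {m})) \<and> set (fill w (A - {m})) = A - {m}"
    using Cons.prems m by (intro Cons.IH) auto
  moreover have "fill (c # w) A = m # fill w (A - {m})"
    by (simp add: m_def Let_def)
  ultimately show ?case using m by auto
qed

lemma sigma_perm: "distinct (sigma w)" "set (sigma w) = {1..length w + 1}"
  using fill_perm[of "{1..length w + 1}" w] by (simp_all add: sigma_def)

definition order_iso :: "nat list \<Rightarrow> nat list \<Rightarrow> bool" where
  "order_iso s p \<longleftrightarrow> length s = length p \<and>
     (\<forall>i < length p. \<forall>j < length p. s ! i < s ! j \<longleftrightarrow> p ! i < p ! j)"

definition contains_pattern :: "nat list \<Rightarrow> nat list \<Rightarrow> bool" where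
  "contains_pattern t p \<longleftrightarrow> (\<exists>s. subseq s t \<and> order_iso s p)"

definition circ :: "nat list \<Rightarrow> nat list set" where
  "circ p = {rotate k p | k. True}"

text \<open>
  Containment is a relation between rotation classes.  By \<open>circ_contains_iff\<close> below it does not
  depend on the representative of the pattern class: \<open>[\<sigma>]\<close> contains \<open>[\<pi>]\<close> iff some rotation of
  \<open>\<sigma>\<close> has a subsequence that is order-isomorphic to \<open>\<pi>\<close>.
\<close>

definition circ_contains :: "nat list set \<Rightarrow> nat list set \<Rightarrow> bool" where
  "circ_contains C D \<longleftrightarrow> (\<exists>t \<in> C. \<exists>p \<in> D. contains_pattern t p)"

lemma order_iso_rotate1:
  assumes "order_iso s p"
  shows "order_iso (rotate1 s) (rotate1 p)"
proof -
  have len: "length s = length p" using assms by (simp add: order_iso_def)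
  show ?thesis
  proof (cases "p = []")
    case True
    then show ?thesis using len by (simp add: order_iso_def)
  next
    case False
    have "Suc i mod length p < length p" for i using False by simp
    then show ?thesis using assms len by (simp add: order_iso_def nth_rotate1)
  qed
qed

lemma subseq_rotate1:
  assumes "subseq s t"
  shows "\<exists>k. subseq (rotate1 s) (rotate k t)"
proof (cases s)
  case Nil
  then show ?thesis by simp
next
  case (Cons a s')
  then obtain u v where t: "t = u @ a # v" and v: "subseq s' v"
    using list_emb_ConsD[of "(=)" a s' t] assms by blast
  have "t = (u @ [a]) @ v" using t by simp
  then have "rotate (length (u @ [a])) t = v @ (u @ [a])"
    by (simp only: rotate_append)
  moreover have "subseq (s' @ [a]) (v @ (u @ [a]))"
    by (intro list_emb_append_mono[OF v] list_emb_append2) simp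
  moreover have "rotate1 s = s' @ [a]" using Cons by simp
  ultimately show ?thesis by metis
qed

lemma contains_pattern_rotate:
  assumes "contains_pattern t p"
  shows "\<exists>k. contains_pattern (rotate k t) (rotate m p)"
proof (induction m)
  case 0
  show ?case using assms by (intro exI[of _ 0]) simp
next
  case (Suc m)
  then obtain k s where s: "subseq s (rotate k t)" "order_iso s (rotate m p)"
    unfolding contains_pattern_def by blast
  obtain l where "subseq (rotate1 s) (rotate l (rotate k t))"
    using subseq_rotate1[OF s(1)] by blast
  then have "contains_pattern (rotate (l + k) t) (rotate (Suc m) p)"
    using order_iso_rotate1[OF s(2)] unfolding contains_pattern_def
    by (auto simp: rotate_rotate)
  then show ?case by blast
qed

lemma rotate_back: "\<exists>m. rotate m (rotate k p) = p"
proof (cases "p = []")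
  case True
  then show ?thesis by simp
next
  case False
  have "rotate (length p - k mod length p) (rotate (k mod length p) p) = p"
    using False by (simp add: rotate_rotate less_imp_le)
  then show ?thesis using rotate_conv_mod[of k p] by auto
qed

lemma circ_contains_iff:
  "circ_contains (circ s) (circ p) \<longleftrightarrow> (\<exists>k. contains_pattern (rotate k s) p)"
proof
  assume "circ_contains (circ s) (circ p)"
  then obtain k l where "contains_pattern (rotate k s) (rotate l p)"
    unfolding circ_contains_def circ_def by blast
  moreover obtain m where "rotate m (rotate l p) = p"
    using rotate_back by blast
  ultimately obtain j where "contains_pattern (rotate j (rotate k s)) p"
    using contains_pattern_rotate[of "rotate k s" "rotate l p" m] by auto
  then have "contains_pattern (rotate (j + k) s) p"
    by (simp add: rotate_rotate)
  then show "\<exists>k. contains_pattern (rotate k s) p" by blast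
next
  assume "\<exists>k. contains_pattern (rotate k s) p"
  moreover have "p \<in> circ p" unfolding circ_def by (metis (mono_tags, lifting) mem_Collect_eq rotate0 id_apply)
  ultimately show "circ_contains (circ s) (circ p)"
    unfolding circ_contains_def circ_def by blast
qed

end

theory Submission
  imports Defs
begin

text \<open>
  An entry of \<open>\<sigma>(w)\<close> lies below or above all later entries according to its letter, so a
  subsequence of \<open>\<sigma>(w)\<close> is order-isomorphic to some \<open>\<sigma>(v)\<close> with \<open>v\<close> a subsequence of \<open>w\<close>.  It
  remains to see when \<open>\<sigma>(w') = X Y\<close> and \<open>\<sigma>(v) = Y X\<close> with \<open>X\<close>, \<open>Y\<close> nonempty.  The first entries of
  \<open>X\<close> and \<open>Y\<close> are extreme; if that of \<open>X\<close> is the smaller one, it is the minimum and that of \<open>Y\<close> is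
  the maximum.  Hence \<open>X\<close> is read with letters 0 only and \<open>Y\<close> with letters 1 only, which gives
  $w' = 0^{a+1}1^b$ and $v = 1^{b+1}0^a$.
\<close>

section \<open>Sequences encoded by a word\<close>

text \<open>This describes the sequences order-isomorphic to \<open>sigma w\<close> without
  standardizing them, so that subsequences and swapped pieces keep their values. The last entry has
  no later entry to be compared with, hence no letter.\<close>

definition encodes :: "bool list \<Rightarrow> 'a::linorder list \<Rightarrow> bool" where
  "encodes w s \<longleftrightarrow> length s = Suc (length w) \<and>
     (\<forall>i j. i < j \<longrightarrow> j < length s \<longrightarrow> (if w ! i then s ! j < s ! i else s ! i < s ! j))"

lemma encodes_length: "encodes w s \<Longrightarrow> length s = Suc (length w)"
  by (simp add: encodes_def)

lemma encodes_Nil [simp]: "encodes [] s \<longleftrightarrow> length s = 1"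
  by (auto simp: encodes_def)

lemma encodes_Nil_right [simp]: "\<not> encodes w []"
  by (simp add: encodes_def)

lemma encodes_Cons [simp]:
  "encodes (c # w) (x # s) \<longleftrightarrow> (\<forall>y\<in>set s. if c then y < x else x < y) \<and> encodes w s"
    (is "?L \<longleftrightarrow> ?R")
proof
  assume ?L
  then have len: "length s = Suc (length w)"
    by (simp add: encodes_def)
  have ord: "if (c # w) ! i then (x # s) ! j < (x # s) ! i else (x # s) ! i < (x # s) ! j"
    if "i < j" "j < Suc (length s)" for i j
    using \<open>?L\<close> that unfolding encodes_def length_Cons by blast
  have "if c then s ! j < x else x < s ! j" if "j < length s" for j
    using ord[of 0 "Suc j"] that by (simp split: if_splits)
  moreover have "if w ! i then s ! j < s ! i else s ! i < s ! j" if "i < j" "j < length s" for i j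
    using ord[of "Suc i" "Suc j"] that by (simp split: if_splits)
  ultimately show ?R
    using len by (fastforce simp: encodes_def in_set_conv_nth)
next
  assume ?R
  then show ?L
    by (auto simp: encodes_def nth_Cons split: nat.splits)
qed

text \<open>Comparing each entry with its successor already recovers the letter.\<close>

lemma encodes_unique:
  assumes "encodes v s" "encodes w s"
  shows "v = w"
proof (rule nth_equalityI)
  show "length v = length w"
    using assms by (simp add: encodes_def)
  fix i assume "i < length v"
  then have "Suc i < length s"
    using assms(1) by (simp add: encodes_def)
  then have "if v ! i then s ! Suc i < s ! i else s ! i < s ! Suc i"
    "if w ! i then s ! Suc i < s ! i else s ! i < s ! Suc i"
    using assms by (simp_all add: encodes_def)
  then show "v ! i = w ! i"
    by (auto split: if_splits)
qed

text \<open>The order of two entries is decided by the letter at the earlier position.\<close>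

lemma encodes_order_iso:
  assumes "encodes w s" "encodes w t"
  shows "order_iso s t"
proof -
  have len: "length s = length t"
    using assms by (simp add: encodes_def)
  have "s ! i < s ! j \<longleftrightarrow> t ! i < t ! j" if "i < length t" "j < length t" for i j
  proof (cases i j rule: linorder_cases)
    case less
    then have "if w ! i then s ! j < s ! i else s ! i < s ! j"
      "if w ! i then t ! j < t ! i else t ! i < t ! j"
      using assms that len by (simp_all add: encodes_def)
    then show ?thesis by (auto split: if_splits)
  next
    case greater
    then have "if w ! j then s ! i < s ! j else s ! j < s ! i"
      "if w ! j then t ! i < t ! j else t ! j < t ! i"
      using assms that len by (simp_all add: encodes_def)
    then show ?thesis by (auto split: if_splits)
  qed simp
  then show ?thesis
    using len by (simp add: order_iso_def)
qed

lemma order_iso_encodes: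
  assumes "order_iso s t" "encodes w t"
  shows "encodes w s"
  using assms by (auto simp: order_iso_def encodes_def)

lemma fill_encodes:
  "finite A \<Longrightarrow> card A = Suc (length w) \<Longrightarrow> encodes w (fill w A)"
proof (induction w arbitrary: A)
  case (Cons c w)
  define m where "m = (if c then Max A else Min A)"
  have "A \<noteq> {}"
    using Cons.prems by auto
  then have "m \<in> A"
    using Cons.prems by (simp add: m_def)
  then have A: "finite (A - {m})" "card (A - {m}) = Suc (length w)"
    using Cons.prems by auto
  have "if c then y < m else m < y" if "y \<in> A - {m}" for y
    using that Cons.prems(1) by (auto simp: m_def order_less_le)
  then show ?case
    using Cons.IH[OF A] fill_perm[OF A] by (simp add: m_def[symmetric] Let_def)
qed simp

lemma sigma_encodes: "encodes w (sigma w)"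
  by (simp add: sigma_def fill_encodes)

section \<open>Subsequences and subwords\<close>

text \<open>Being extreme among all later entries survives deletions, so every chosen entry but the
  last keeps its letter. The letter of the last chosen entry, if it has one, is dropped.\<close>

lemma subseq_encoded:
  assumes "encodes w s" "subseq t s" "t \<noteq> []"
  obtains v where "subseq v w" "encodes v t"
proof -
  have "\<exists>v. subseq v w \<and> encodes v t"
    using assms
  proof (induction w arbitrary: s t)
    case Nil
    then obtain x where "s = [x]"
      by (auto simp: length_Suc_conv)
    then have "t = [x]"
      using Nil.prems by (cases t) (auto split: if_splits dest: list_emb_Nil2)
    then show ?case by auto
  next
    case (Cons c w)
    then obtain x s' where s: "s = x # s'"
      by (cases s) auto
    obtain y t' where t: "t = y # t'"
      using Cons.prems(3) by (cases t) auto
    have s': "encodes w s'"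
      using Cons.prems(1) s by simp
    show ?case
    proof (cases "subseq t s'")
      case True
      then show ?thesis
        using Cons.IH[OF s' True Cons.prems(3)] by auto
    next
      case False
      then have y: "y = x" and t': "subseq t' s'"
        using Cons.prems(2) s t by (auto split: if_splits dest: subseq_Cons')
      show ?thesis
      proof (cases "t' = []")
        case True
        then show ?thesis
          using t by (intro exI[of _ "[]"]) simp
      next
        case False
        then obtain v where "subseq v w" "encodes v t'"
          using Cons.IH[OF s' t'] by blast
        moreover have "set t' \<subseteq> set s'"
          using t' by (auto dest: list_emb_set)
        ultimately have "encodes (c # v) t" "subseq (c # v) (c # w)"
          using Cons.prems(1) s t y by auto
        then show ?thesis by blast
      qed
    qed
  qed
  then show thesis
    using that by blast
qed

text \<open>The entries at the positions of the chosen letters are taken, together with the last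
  entry of \<open>s\<close>, which ends the sequence without a letter.\<close>

lemma encoded_subseq:
  assumes "encodes w s" "subseq v w"
  obtains t where "subseq t s" "encodes v t"
proof -
  have "\<exists>t. subseq t s \<and> encodes v t"
    using assms
  proof (induction w arbitrary: s v)
    case Nil
    then have "v = []"
      by (auto dest: list_emb_Nil2)
    then show ?case
      using Nil.prems(1) by blast
  next
    case (Cons c w)
    then obtain x s' where s: "s = x # s'"
      by (cases s) auto
    have s': "encodes w s'"
      using Cons.prems(1) s by simp
    show ?case
    proof (cases "subseq v w")
      case True
      then show ?thesis
        using Cons.IH[OF s' True] s by auto
    next
      case False
      then obtain v' where v: "v = c # v'" "subseq v' w"
        using Cons.prems(2) by (cases v) (auto split: if_splits)
      then obtain t where t: "subseq t s'" "encodes v' t"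
        using Cons.IH[OF s'] by blast
      have "set t \<subseteq> set s'"
        using t(1) by (auto dest: list_emb_set)
      then have "encodes v (x # t)" "subseq (x # t) s"
        using Cons.prems(1) s t v by auto
      then show ?thesis by blast
    qed
  qed
  then show thesis
    using that by blast
qed

section \<open>Constant blocks and exchange of two pieces\<close>

lemma encodes_replicate_append:
  assumes "ys \<noteq> []"
  shows "encodes (replicate (length xs) c @ u) (xs @ ys) \<longleftrightarrow>
    sorted_wrt (\<lambda>x y. if c then y < x else x < y) xs \<and>
    (\<forall>x\<in>set xs. \<forall>y\<in>set ys. if c then y < x else x < y) \<and> encodes u ys"
  using assms by (induction xs) (auto split: if_splits)

lemma encodes_replicate:
  assumes "xs \<noteq> []"
  shows "encodes (replicate (length xs - 1) c) xs \<longleftrightarrow>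
    sorted_wrt (\<lambda>x y. if c then y < x else x < y) xs"
  using assms
proof (induction xs)
  case (Cons x xs)
  then show ?case
    by (cases xs) (auto split: if_splits)
qed simp

text \<open>Both sides express the same symmetric condition: \<open>xs\<close> and \<open>ys\<close>
  are monotone in opposite directions, and all of \<open>xs\<close> lies on one side of all of
  \<open>ys\<close>, as fixed by \<open>c\<close>.\<close>

lemma encodes_two_blocks:
  assumes "xs \<noteq> []" "ys \<noteq> []"
  shows "encodes (replicate (length xs) c @ replicate (length ys - 1) (\<not> c)) (xs @ ys) \<longleftrightarrow>
    encodes (replicate (length ys) (\<not> c) @ replicate (length xs - 1) c) (ys @ xs)"
  using encodes_replicate_append[of ys xs c] encodes_replicate_append[of xs ys "\<not> c"]
    encodes_replicate[of xs c] encodes_replicate[of ys "\<not> c"] assms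
  by auto

text \<open>The entry \<open>y\<close> comes after all of \<open>xs\<close>, so a comparison with
  \<open>y\<close> alone determines each of these letters.\<close>

lemma encodes_append_constant:
  assumes "encodes w (xs @ y # ys)" "\<forall>x\<in>set xs. if c then y < x else x < y"
  shows "\<exists>u. w = replicate (length xs) c @ u \<and> encodes u (y # ys)"
  using assms
proof (induction xs arbitrary: w)
  case (Cons x xs)
  obtain d w' where w: "w = d # w'"
    using Cons.prems(1) by (cases w) auto
  then have "d = c"
    using Cons.prems by (auto split: if_splits)
  then show ?case
    using Cons w by auto
qed simp

text \<open>Each of \<open>x\<close> and \<open>y\<close> leads one of the two arrangements, so
  \<open>x\<close> is the minimum and \<open>y\<close> the maximum. The entries of \<open>xs\<close>
  then precede the larger \<open>y\<close> in one arrangement, and those of \<open>ys\<close>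
  precede the smaller \<open>x\<close> in the other, so both leading blocks are constant.\<close>

lemma encodes_swap_less:
  assumes v: "encodes v (x # xs @ y # ys)" and u: "encodes u (y # ys @ x # xs)" and "x < y"
  shows "v = replicate (Suc (length xs)) False @ replicate (length ys) True"
    and "u = replicate (Suc (length ys)) True @ replicate (length xs) False"
proof -
  obtain d v' where "v = d # v'"
    using v by (cases v) auto
  then have x: "\<forall>z\<in>set (xs @ y # ys). x < z"
    using v \<open>x < y\<close> by (auto split: if_splits)
  obtain e u' where "u = e # u'"
    using u by (cases u) auto
  then have y: "\<forall>z\<in>set (ys @ x # xs). z < y"
    using u \<open>x < y\<close> by (auto split: if_splits)
  obtain p where p: "v = replicate (length (x # xs)) False @ p"
    using encodes_append_constant[of v "x # xs" y ys False] v y \<open>x < y\<close> by auto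
  obtain q where q: "u = replicate (length (y # ys)) True @ q"
    using encodes_append_constant[of u "y # ys" x xs True] u x \<open>x < y\<close> by auto
  \<comment> \<open>The words exchange information: \<open>p\<close> encodes the piece that the
    block of 1s in \<open>u\<close> makes decreasing, and \<open>q\<close> the piece that the block
    of 0s in \<open>v\<close> makes increasing.\<close>
  have "encodes p (y # ys)" "sorted_wrt (<) (x # xs)"
    using v encodes_replicate_append[of "y # ys" "x # xs" False p] unfolding p by auto
  moreover have "encodes q (x # xs)" "sorted_wrt (\<lambda>x y. y < x) (y # ys)"
    using u encodes_replicate_append[of "x # xs" "y # ys" True q] unfolding q by auto
  ultimately have "p = replicate (length ys) True" "q = replicate (length xs) False"
    using encodes_replicate[of "y # ys" True] encodes_replicate[of "x # xs" False]
    by (auto intro: encodes_unique)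
  then show "v = replicate (Suc (length xs)) False @ replicate (length ys) True"
    "u = replicate (Suc (length ys)) True @ replicate (length xs) False"
    using p q by auto
qed

lemma encodes_swap:
  assumes "encodes v (xs @ ys)" "encodes u (ys @ xs)"
  shows "u = v \<or> (\<exists>a b. v = replicate (a + 1) False @ replicate b True
      \<and> u = replicate (b + 1) True @ replicate a False)
    \<or> (\<exists>a b. v = replicate (b + 1) True @ replicate a False
      \<and> u = replicate (a + 1) False @ replicate b True)"
proof (cases "xs = [] \<or> ys = []")
  case True
  then show ?thesis
    using assms by (auto intro: encodes_unique)
next
  case False
  then obtain x xs' y ys' where xy: "xs = x # xs'" "ys = y # ys'"
    by (meson neq_Nil_conv)
  obtain d v' where "v = d # v'"
    using assms(1) xy by (cases v) auto
  then have "x \<noteq> y"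
    using assms(1) xy by (auto split: if_splits)
  then consider "x < y" | "y < x"
    by fastforce
  then show ?thesis
  proof cases
    case 1
    then show ?thesis
      using encodes_swap_less[of v x xs' y ys' u] assms xy by auto
  next
    case 2
    then show ?thesis
      using encodes_swap_less[of u y ys' x xs' v] assms xy by auto
  qed
qed

section \<open>Circular containment in terms of words\<close>

text \<open>The point where the rotation wraps around cuts \<open>s\<close> into two pieces,
  possibly empty, which occur in \<open>t\<close> in exchanged order.\<close>

lemma subseq_rotate_iff:
  "(\<exists>k. subseq s (rotate k t)) \<longleftrightarrow> (\<exists>xs ys. s = xs @ ys \<and> subseq (ys @ xs) t)"
proof
  assume "\<exists>k. subseq s (rotate k t)"
  then obtain k where "subseq s (rotate k t)" ..
  then obtain n where "subseq s (drop n t @ take n t)"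
    by (metis rotate_drop_take)
  then obtain xs ys where "s = xs @ ys" "subseq xs (drop n t)" "subseq ys (take n t)"
    by (auto simp: subseq_append_iff)
  then show "\<exists>xs ys. s = xs @ ys \<and> subseq (ys @ xs) t"
    by (metis append_take_drop_id list_emb_append_mono)
next
  assume "\<exists>xs ys. s = xs @ ys \<and> subseq (ys @ xs) t"
  then obtain xs ys t1 t2 where "s = xs @ ys" "t = t1 @ t2" "subseq ys t1" "subseq xs t2"
    by (metis list_emb_appendD)
  then have "subseq s (rotate (length t1) t)"
    by (simp add: rotate_append list_emb_append_mono)
  then show "\<exists>k. subseq s (rotate k t)" ..
qed

lemma circ_contains_sigma_iff_encodes:
  "circ_contains (circ (sigma w)) (circ (sigma w')) \<longleftrightarrow>
    (\<exists>xs ys. encodes w' (xs @ ys) \<and> subseq (ys @ xs) (sigma w))"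
proof -
  have "order_iso s (sigma w') \<longleftrightarrow> encodes w' s" for s
    using order_iso_encodes encodes_order_iso sigma_encodes by blast
  then show ?thesis
    unfolding circ_contains_iff contains_pattern_def using subseq_rotate_iff by metis
qed

lemma circ_contains_two_blocks:
  assumes "subseq (replicate (Suc m) (\<not> c) @ replicate n c) w"
  shows "circ_contains (circ (sigma w)) (circ (sigma (replicate (Suc n) c @ replicate m (\<not> c))))"
proof -
  obtain t where t: "subseq t (sigma w)" "encodes (replicate (Suc m) (\<not> c) @ replicate n c) t"
    using encoded_subseq[OF sigma_encodes assms] .
  \<comment> \<open>One entry more than letters: the cut after \<open>Suc m\<close> entries leaves
    \<open>Suc n\<close>, so each piece, once moved to the end, has one letter fewer than
    entries.\<close>
  define ys xs where "ys = take (Suc m) t" and "xs = drop (Suc m) t"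
  have "length t = Suc (Suc m + n)"
    using encodes_length[OF t(2)] by simp
  then have len: "length ys = Suc m" "length xs = Suc n"
    by (simp_all add: xs_def ys_def)
  then have "xs \<noteq> []" "ys \<noteq> []"
    by auto
  moreover have t_eq: "t = ys @ xs"
    by (simp add: xs_def ys_def)
  ultimately have "encodes (replicate (Suc n) c @ replicate m (\<not> c)) (xs @ ys)"
    using encodes_two_blocks[of xs ys c] t(2) len by simp
  then show ?thesis
    using t(1) unfolding t_eq circ_contains_sigma_iff_encodes by blast
qed

text \<open>The first alternative needs no rotation. The other two are the only words that an
  exchange of nonempty pieces can produce, by \<open>encodes_swap\<close>.\<close>

lemma circ_contains_sigma_iff:
  "circ_contains (circ (sigma w)) (circ (sigma w')) \<longleftrightarrow> subseq w' w
    \<or> (\<exists>a b. w' = replicate (a + 1) False @ replicate b True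
        \<and> subseq (replicate (b + 1) True @ replicate a False) w)
    \<or> (\<exists>a b. w' = replicate (b + 1) True @ replicate a False
        \<and> subseq (replicate (a + 1) False @ replicate b True) w)"
    (is "?L \<longleftrightarrow> ?R")
proof
  assume ?L
  then obtain xs ys where w': "encodes w' (xs @ ys)" and sub: "subseq (ys @ xs) (sigma w)"
    unfolding circ_contains_sigma_iff_encodes by blast
  have "ys @ xs \<noteq> []"
    using w' by auto
  then obtain v where "subseq v w" "encodes v (ys @ xs)"
    using subseq_encoded[OF sigma_encodes sub] by blast
  then show ?R
    using encodes_swap[OF w'] by blast
next
  assume ?R
  then consider "subseq w' w"
    | a b where "w' = replicate (a + 1) False @ replicate b True"
        "subseq (replicate (b + 1) True @ replicate a False) w"
    | a b where "w' = replicate (b + 1) True @ replicate a False"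
        "subseq (replicate (a + 1) False @ replicate b True) w"
    by blast
  then show ?L
  proof cases
    case 1
    then obtain t where "subseq t (sigma w)" "encodes w' t"
      using encoded_subseq[OF sigma_encodes] by blast
    then show ?thesis
      unfolding circ_contains_sigma_iff_encodes by (metis append.right_neutral append_Nil)
  next
    case 2
    then show ?thesis
      using circ_contains_two_blocks[of b False a w] by simp
  next
    case 3
    then show ?thesis
      using circ_contains_two_blocks[of a True b w] by simp
  qed
qed

section \<open>Runs of two-block words and the three cases\<close>

lemma card_runs_two_blocks:
  assumes "c \<noteq> d"
  shows "card (runs (replicate m c @ replicate n d)) \<le> 2"
proof -
  let ?w = "replicate m c @ replicate n d"
  have "runs ?w \<subseteq> {(0, m - 1), (m, m + n - 1)}"
  proof
    fix r assume r: "r \<in> runs ?w"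
    obtain i j where ij: "r = (i, j)"
      by fastforce
    have le: "i \<le> j" "j < m + n" and const: "?w ! j = ?w ! i"
      and left: "i = 0 \<or> ?w ! (i - 1) \<noteq> ?w ! i"
      and right: "Suc j = m + n \<or> ?w ! Suc j \<noteq> ?w ! j"
      using r unfolding ij runs_def mem_Collect_eq prod.case length_append length_replicate
      by blast+
    \<comment> \<open>Letters agree exactly when their positions lie on the same side of
      \<open>m\<close>. This turns the conditions on a run into linear arithmetic, also when a block
      is empty.\<close>
    have eq: "?w ! i = ?w ! j \<longleftrightarrow> (i < m \<longleftrightarrow> j < m)" if "i < m + n" "j < m + n" for i j
      using that assms by (simp add: nth_append)
    have "i < m \<longleftrightarrow> j < m"
      using const eq[of j i] le by linarith
    moreover have "i = 0 \<or> (i - 1 < m \<longleftrightarrow> \<not> i < m)"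
      using left eq[of "i - 1" i] le by linarith
    moreover have "Suc j = m + n \<or> (Suc j < m \<longleftrightarrow> \<not> j < m)"
      using right eq[of "Suc j" j] le by linarith
    ultimately have "i = 0 \<and> j = m - 1 \<or> i = m \<and> j = m + n - 1"
      using le by linarith
    then show "r \<in> {(0, m - 1), (m, m + n - 1)}"
      using ij by simp
  qed
  then have "card (runs ?w) \<le> card {(0, m - 1), (m, m + n - 1)}"
    by (rule card_mono[rotated]) simp
  also have "\<dots> \<le> 2"
    by (rule order_trans[OF card_insert_le_m1]) auto
  finally show ?thesis .
qed

lemma two_blocks_eq_iff:
  assumes "c \<noteq> d"
  shows "replicate m c @ replicate n d = replicate m' c @ replicate n' d \<longleftrightarrow> m = m' \<and> n = n'"
proof
  assume "replicate m c @ replicate n d = replicate m' c @ replicate n' d"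
  then have "count_list (replicate m c @ replicate n d) x
      = count_list (replicate m' c @ replicate n' d) x" for x
    by simp
  from this[of c] this[of d] show "m = m' \<and> n = n'"
    using assms by (simp add: count_list_eq_length_filter)
qed simp

theorem theorem3p9:
  fixes w w' :: "bool list"
  shows "(card (runs w') > 2 \<longrightarrow>
           (circ_contains (circ (sigma w)) (circ (sigma w')) \<longleftrightarrow> subseq w' w))
    \<and> (\<forall>a b. w' = replicate (a + 1) False @ replicate b True \<longrightarrow>
           (circ_contains (circ (sigma w)) (circ (sigma w')) \<longleftrightarrow>
              subseq (replicate (a + 1) False @ replicate b True) w
            \<or> subseq (replicate (b + 1) True @ replicate a False) w))
    \<and> (\<forall>a b. w' = replicate (b + 1) True @ replicate a False \<longrightarrow>
           (circ_contains (circ (sigma w)) (circ (sigma w')) \<longleftrightarrow>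
              subseq (replicate (a + 1) False @ replicate b True) w
            \<or> subseq (replicate (b + 1) True @ replicate a False) w))"
proof (intro conjI impI allI)
  assume "card (runs w') > 2"
  \<comment> \<open>Both exceptional alternatives of \<open>circ_contains_sigma_iff\<close> are
    two-block words, so more than two runs leave only the first.\<close>
  then have "w' \<noteq> replicate m c @ replicate n d" if "c \<noteq> d" for m n c d
    using card_runs_two_blocks[OF that, of m n] by auto
  then show "circ_contains (circ (sigma w)) (circ (sigma w')) \<longleftrightarrow> subseq w' w"
    unfolding circ_contains_sigma_iff by blast
next
  fix a b assume w': "w' = replicate (a + 1) False @ replicate b True"
  have same: "w' = replicate (a' + 1) False @ replicate b' True \<longleftrightarrow> a' = a \<and> b' = b" for a' b'
    unfolding w' using two_blocks_eq_iff[of False True] by auto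
  \<comment> \<open>The leading block of either form is nonempty, so the first letters differ and
    only one exceptional alternative survives.\<close>
  have other: "w' = replicate (b' + 1) True @ replicate a' False \<longleftrightarrow> False" for a' b'
    unfolding w' by simp
  show "circ_contains (circ (sigma w)) (circ (sigma w')) \<longleftrightarrow>
      subseq (replicate (a + 1) False @ replicate b True) w
    \<or> subseq (replicate (b + 1) True @ replicate a False) w"
    unfolding circ_contains_sigma_iff same other by (auto simp: w' simp del: replicate_Suc)
next
  fix a b assume w': "w' = replicate (b + 1) True @ replicate a False"
  have same: "w' = replicate (b' + 1) True @ replicate a' False \<longleftrightarrow> a' = a \<and> b' = b" for a' b'
    unfolding w' using two_blocks_eq_iff[of True False] by auto
  have other: "w' = replicate (a' + 1) False @ replicate b' True \<longleftrightarrow> False" for a' b'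
    unfolding w' by simp
  show "circ_contains (circ (sigma w)) (circ (sigma w')) \<longleftrightarrow>
      subseq (replicate (a + 1) False @ replicate b True) w
    \<or> subseq (replicate (b + 1) True @ replicate a False) w"
    unfolding circ_contains_sigma_iff same other by (auto simp: w' simp del: replicate_Suc)
qed

end
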